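(* For $\lambda\in[0,1]$ let $T_\lambda=\lambda W_3^+ + (1-\lambda)W_3^-$. Then for every $\lambda\in[1/4,1]$ and every integer $k\geq 2$, $T_\lambda^{\otimes k}\in\mathrm{conv}(\mathrm{Aut}(M_{3^k}(\mathbb{C})))$.
   Context: The Holevo–Werner channels on $M_3(\mathbb{C})$ are $W_3^+(x)=\frac{1}{4}(\mathrm{Tr}_3(x)1_3+x^t)$ and $W_3^-(x)=\frac{1}{2}(\mathrm{Tr}_3(x)1_3-x^t)$, where $\mathrm{Tr}_3$ is the non-normalized trace and $x^t$ the transpose. $T_\lambda^{\otimes k}$ acts on $M_3(\mathbb{C})^{\otimes k}$, identified with $M_{3^k}(\mathbb{C})$. $\mathrm{Aut}(M_m(\mathbb{C}))$ is the set of maps $x\mapsto u^*xu$ with $u\in M_m(\mathbb{C})$ unitary and $\mathrm{conv}$ denotes convex hull. *)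

theory Defs
  imports Complex_Main "Jordan_Normal_Form.Matrix"
begin

definition mtrace :: "complex mat \<Rightarrow> complex" where
  "mtrace A = (\<Sum>i<dim_row A. A $$ (i, i))"

definition adj :: "complex mat \<Rightarrow> complex mat" where
  "adj U = mat (dim_col U) (dim_row U) (\<lambda>(i, j). cnj (U $$ (j, i)))"

definition unitary_mat :: "nat \<Rightarrow> complex mat \<Rightarrow> bool" where
  "unitary_mat n U \<longleftrightarrow> U \<in> carrier_mat n n \<and> adj U * U = 1\<^sub>m n \<and> U * adj U = 1\<^sub>m n"

definition W3plus :: "complex mat \<Rightarrow> complex mat" where
  "W3plus X = (1/4) \<cdot>\<^sub>m (mtrace X \<cdot>\<^sub>m 1\<^sub>m 3 + transpose_mat X)"

definition W3minus :: "complex mat \<Rightarrow> complex mat" where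
  "W3minus X = (1/2) \<cdot>\<^sub>m (mtrace X \<cdot>\<^sub>m 1\<^sub>m 3 - transpose_mat X)"

definition T_lam :: "real \<Rightarrow> complex mat \<Rightarrow> complex mat" where
  "T_lam l X = complex_of_real l \<cdot>\<^sub>m W3plus X + complex_of_real (1 - l) \<cdot>\<^sub>m W3minus X"

text \<open>Kronecker product; M_a \<otimes> M_b identified with M_{ab} via (i,k) \<mapsto> i*b+k.\<close>
definition kron :: "complex mat \<Rightarrow> complex mat \<Rightarrow> complex mat" where
  "kron A B = mat (dim_row A * dim_row B) (dim_col A * dim_col B)
     (\<lambda>(i, j). A $$ (i div dim_row B, j div dim_col B) * B $$ (i mod dim_row B, j mod dim_col B))"

definition munit :: "nat \<Rightarrow> nat \<Rightarrow> nat \<Rightarrow> complex mat" where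
  "munit n i j = mat n n (\<lambda>(a, b). if a = i \<and> b = j then 1 else 0)"

definition tensor_map :: "nat \<Rightarrow> (complex mat \<Rightarrow> complex mat) \<Rightarrow> nat \<Rightarrow> (complex mat \<Rightarrow> complex mat)
    \<Rightarrow> complex mat \<Rightarrow> complex mat" where
  "tensor_map a Phi b Psi X = mat (a * b) (a * b) (\<lambda>(p, q).
     (\<Sum>i<a. \<Sum>j<a. \<Sum>k<b. \<Sum>l<b.
        X $$ (i * b + k, j * b + l) * (kron (Phi (munit a i j)) (Psi (munit b k l))) $$ (p, q)))"

fun tensor_pow :: "nat \<Rightarrow> (complex mat \<Rightarrow> complex mat) \<Rightarrow> nat \<Rightarrow> complex mat \<Rightarrow> complex mat" where
  "tensor_pow d Phi 0 = (\<lambda>X. X)"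
| "tensor_pow d Phi (Suc k) = tensor_map (d ^ k) (tensor_pow d Phi k) d Phi"

definition in_conv_Aut :: "nat \<Rightarrow> (complex mat \<Rightarrow> complex mat) \<Rightarrow> bool" where
  "in_conv_Aut N Phi \<longleftrightarrow> (\<exists>(m::nat) (p::nat \<Rightarrow> real) (U::nat \<Rightarrow> complex mat).
     (\<forall>i<m. p i \<ge> 0 \<and> unitary_mat N (U i)) \<and> (\<Sum>i<m. p i) = 1 \<and>
     (\<forall>X \<in> carrier_mat N N. Phi X =
        mat N N (\<lambda>(a, b). \<Sum>i<m. complex_of_real (p i) * (adj (U i) * X * U i) $$ (a, b))))"

end

theory Submission
  imports Defs
begin

text \<open>Both \<open>W\<^sub>3\<^sup>+\<close> and \<open>W\<^sub>3\<^sup>-\<close> are covariant, so averaging \<open>x \<mapsto> U\<^sup>* x U\<close>, with \<open>U\<close> a unitary of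
  \<open>M\<^sub>3 \<otimes> M\<^sub>3\<close>, over \<open>U \<mapsto> (g \<otimes> h) U (g \<otimes> h)\<^sup>t\<close> for \<open>g\<close>, \<open>h\<close> in a finite 2-design yields a
  mixture of the four maps \<open>W\<^sub>3\<^sup>\<plusminus> \<otimes> W\<^sub>3\<^sup>\<plusminus>\<close>; the weights are the squared norms of the parts of \<open>U\<close> which
  are symmetric or antisymmetric under the two partial transpositions. A monomial unitary \<open>V\<close> with
  cube roots of unity as entries gives \<open>(W\<^sup>+ \<otimes> W\<^sup>- + W\<^sup>- \<otimes> W\<^sup>+ + W\<^sup>- \<otimes> W\<^sup>-) / 3\<close>, and a reflection \<open>K\<close> gives
  \<open>2/27 W\<^sup>+ \<otimes> W\<^sup>+ + 25/27 W\<^sup>- \<otimes> W\<^sup>-\<close>; on \<open>M\<^sub>3\<close> one reaches \<open>T\<^sub>\<lambda>\<close> for all \<open>\<lambda> \<ge> 1/3\<close>. For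
  \<open>1/4 \<le> \<lambda> \<le> 1/3\<close>, \<open>T\<^sub>\<lambda> \<otimes> T\<^sub>\<lambda>\<close> is a convex combination of the maps given by \<open>V\<close> and \<open>K\<close> and of
  \<open>W\<^sup>+ \<otimes> W\<^sup>+\<close>, and the third tensor power is a convex combination of the symmetrizations of \<open>T\<^sub>1\<^sub>/\<^sub>3 \<otimes> V\<close>, \<open>T\<^sub>1\<^sub>/\<^sub>3 \<otimes> K\<close>, \<open>W\<^sup>+ \<otimes> V\<close> and
  \<open>W\<^sup>+ \<otimes> W\<^sup>+ \<otimes> W\<^sup>+\<close>. Every \<open>k \<ge> 2\<close> is a sum of twos and threes.\<close>

subsection \<open>Unitaries and kernels of mixed unitary maps\<close>

text \<open>Matrices are functions on an arbitrary finite index set, so that products and bijections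
  of index sets directly give tensor products and reorderings of factors.\<close>

definition unitary_on :: "'a set \<Rightarrow> ('a \<Rightarrow> 'a \<Rightarrow> complex) \<Rightarrow> bool" where
  "unitary_on I U \<longleftrightarrow> finite I \<and>
     (\<forall>i\<in>I. \<forall>j\<in>I. (\<Sum>k\<in>I. cnj (U k i) * U k j) = of_bool (i = j)) \<and>
     (\<forall>i\<in>I. \<forall>j\<in>I. (\<Sum>k\<in>I. U i k * cnj (U j k)) = of_bool (i = j))"

lemma unitary_on_cong:
  assumes "unitary_on I U" "\<And>i j. i \<in> I \<Longrightarrow> j \<in> I \<Longrightarrow> U i j = V i j"
  shows "unitary_on I V"
  using assms unfolding unitary_on_def by simp

lemma unitary_on_transpose:
  assumes "unitary_on I U"
  shows "unitary_on I (\<lambda>i j. U j i)"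
proof -
  have 1: "(\<Sum>k\<in>I. U k i * cnj (U k j)) = cnj (\<Sum>k\<in>I. cnj (U k i) * U k j)" for i j
    by simp
  have 2: "(\<Sum>k\<in>I. cnj (U i k) * U j k) = cnj (\<Sum>k\<in>I. U i k * cnj (U j k))" for i j
    by simp
  show ?thesis
    using assms unfolding unitary_on_def 1 2 by (simp del: cnj_sum)
qed

lemma unitary_on_mult:
  assumes "unitary_on I U" "unitary_on I V"
  shows "unitary_on I (\<lambda>i j. \<Sum>k\<in>I. U i k * V k j)"
proof -
  have fin: "finite I" using assms by (simp add: unitary_on_def)
  have aux: "(\<Sum>k\<in>I. cnj (\<Sum>m\<in>I. A k m * B m i) * (\<Sum>m\<in>I. A k m * B m j)) = of_bool (i = j)"
    if A: "unitary_on I A" and B: "unitary_on I B" and ij: "i \<in> I" "j \<in> I" for A B i j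
  proof -
    have "(\<Sum>k\<in>I. cnj (\<Sum>m\<in>I. A k m * B m i) * (\<Sum>m\<in>I. A k m * B m j)) =
      (\<Sum>k\<in>I. \<Sum>m\<in>I. \<Sum>n\<in>I. cnj (B m i) * B n j * (cnj (A k m) * A k n))"
      unfolding cnj_sum sum_product complex_cnj_mult by (simp add: mult_ac)
    also have "\<dots> = (\<Sum>m\<in>I. \<Sum>k\<in>I. \<Sum>n\<in>I. cnj (B m i) * B n j * (cnj (A k m) * A k n))"
      by (rule sum.swap)
    also have "\<dots> = (\<Sum>m\<in>I. \<Sum>n\<in>I. \<Sum>k\<in>I. cnj (B m i) * B n j * (cnj (A k m) * A k n))"
      by (intro sum.cong refl sum.swap)
    also have "\<dots> = (\<Sum>m\<in>I. \<Sum>n\<in>I. cnj (B m i) * B n j * (\<Sum>k\<in>I. cnj (A k m) * A k n))"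
      by (simp add: sum_distrib_left)
    also have "\<dots> = (\<Sum>m\<in>I. \<Sum>n\<in>I. cnj (B m i) * B n j * of_bool (m = n))"
      using A by (intro sum.cong refl) (auto simp: unitary_on_def)
    also have "\<dots> = (\<Sum>m\<in>I. cnj (B m i) * B m j)"
      using fin by (intro sum.cong refl) (simp add: of_bool_def if_distrib cong: if_cong)
    also have "\<dots> = of_bool (i = j)"
      using B ij by (simp add: unitary_on_def)
    finally show ?thesis .
  qed
  \<comment> \<open>The row relations are the column relations of the transposes, multiplied in
    reverse order.\<close>
  have "(\<Sum>k\<in>I. (\<Sum>m\<in>I. U i m * V m k) * cnj (\<Sum>m\<in>I. U j m * V m k)) = of_bool (i = j)"
    if "i \<in> I" "j \<in> I" for i j
    using aux[OF unitary_on_transpose[OF assms(2)] unitary_on_transpose[OF assms(1)] that(2,1)]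
    by (simp add: mult.commute eq_commute)
  with aux[OF assms] fin show ?thesis
    by (simp add: unitary_on_def)
qed

lemma unitary_on_tensor:
  assumes "unitary_on I U" "unitary_on J V"
  shows "unitary_on (I \<times> J) (\<lambda>i j. U (fst i) (fst j) * V (snd i) (snd j))"
proof -
  have "(\<Sum>k\<in>I \<times> J. cnj (U (fst k) i * V (snd k) i') * (U (fst k) j * V (snd k) j')) =
      (\<Sum>k\<in>I. cnj (U k i) * U k j) * (\<Sum>k\<in>J. cnj (V k i') * V k j')" for i i' j j'
    by (simp add: sum_product sum.cartesian_product algebra_simps case_prod_beta)
  moreover have "(\<Sum>k\<in>I \<times> J. (U i (fst k) * V i' (snd k)) * cnj (U j (fst k) * V j' (snd k))) =
      (\<Sum>k\<in>I. U i k * cnj (U j k)) * (\<Sum>k\<in>J. V i' k * cnj (V j' k))" for i i' j j'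
    by (simp add: sum_product sum.cartesian_product algebra_simps case_prod_beta)
  ultimately show ?thesis
    using assms by (auto simp: unitary_on_def of_bool_def)
qed

lemma unitary_on_reindex:
  assumes "unitary_on I U" and f: "bij_betw f J I"
  shows "unitary_on J (\<lambda>i j. U (f i) (f j))"
proof -
  have 1: "f i \<in> I" if "i \<in> J" for i using f that by (auto simp: bij_betw_def)
  have 2: "f i = f j \<longleftrightarrow> i = j" if "i \<in> J" "j \<in> J" for i j
    using f that by (auto simp: bij_betw_def inj_on_def)
  have 3: "(\<Sum>k\<in>J. cnj (U (f k) i) * U (f k) j) = (\<Sum>k\<in>I. cnj (U k i) * U k j)" for i j
    by (rule sum.reindex_bij_betw[OF f])
  have 4: "(\<Sum>k\<in>J. U i (f k) * cnj (U j (f k))) = (\<Sum>k\<in>I. U i k * cnj (U j k))" for i j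
    by (rule sum.reindex_bij_betw[OF f])
  show ?thesis
    using assms(1) bij_betw_finite[OF f] unfolding unitary_on_def 3 4 by (simp add: 1 2)
qed

lemma unitary_on_monomial:
  assumes "finite I" and f: "bij_betw f I I" and z: "\<And>i. i \<in> I \<Longrightarrow> cnj (z i) * z i = 1"
  shows "unitary_on I (\<lambda>i j. if j = f i then z i else 0)"
proof -
  have inI: "f i \<in> I" if "i \<in> I" for i using f that by (auto simp: bij_betw_def)
  have inj: "f i = f j \<longleftrightarrow> i = j" if "i \<in> I" "j \<in> I" for i j
    using f that by (auto simp: bij_betw_def inj_on_def)
  have col: "(\<Sum>k\<in>I. cnj (if i = f k then z k else 0) * (if j = f k then z k else 0)) = of_bool (i = j)"
    if ij: "i \<in> I" "j \<in> I" for i j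
  proof -
    have "(\<Sum>k\<in>I. cnj (if i = f k then z k else 0) * (if j = f k then z k else 0)) =
        (\<Sum>k\<in>I. if i = f k then of_bool (i = j) else 0)"
      by (intro sum.cong) (auto simp: z)
    also have "\<dots> = (\<Sum>k\<in>I. if i = k then of_bool (i = j) else 0)"
      by (rule sum.reindex_bij_betw[OF f, where g = "\<lambda>k. if i = k then of_bool (i = j) else 0"])
    finally show ?thesis using ij assms(1) by simp
  qed
  have row: "(\<Sum>k\<in>I. (if k = f i then z i else 0) * cnj (if k = f j then z j else 0)) = of_bool (i = j)"
    if ij: "i \<in> I" "j \<in> I" for i j
  proof -
    have "(\<Sum>k\<in>I. (if k = f i then z i else 0) * cnj (if k = f j then z j else 0)) =
        (\<Sum>k\<in>I. if k = f i then of_bool (i = j) else 0)"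
      using ij by (intro sum.cong) (auto simp: z inj mult.commute[of "z j" for j])
    then show ?thesis using ij assms(1) inI by simp
  qed
  show ?thesis using assms(1) col row by (simp add: unitary_on_def)
qed

lemma unitary_on_id: "finite I \<Longrightarrow> unitary_on I (\<lambda>i j. of_bool (i = j))"
  by (rule unitary_on_cong[OF unitary_on_monomial[of I "\<lambda>i. i" "\<lambda>_. 1"]])
    (auto simp: bij_betw_def)

text \<open>A linear map \<open>\<Phi>\<close> on matrices with index set \<open>I\<close> is represented by its kernel
  \<open>C p q i j = \<Phi>(e\<^sub>i\<^sub>j)\<^sub>p\<^sub>q\<close>; \<open>mixed I r\<close> is \<open>r\<close> times the convex hull of
  the automorphisms \<open>x \<mapsto> U\<^sup>* x U\<close>.\<close>

inductive mixed :: "'a set \<Rightarrow> real \<Rightarrow> ('a \<Rightarrow> 'a \<Rightarrow> 'a \<Rightarrow> 'a \<Rightarrow> complex) \<Rightarrow> bool" for I where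
  ad: "unitary_on I U \<Longrightarrow> mixed I 1 (\<lambda>p q i j. cnj (U i p) * U j q)"
| add: "mixed I r C \<Longrightarrow> mixed I s D \<Longrightarrow> mixed I (r + s) (\<lambda>p q i j. C p q i j + D p q i j)"
| scale: "mixed I r C \<Longrightarrow> 0 \<le> c \<Longrightarrow> mixed I (c * r) (\<lambda>p q i j. complex_of_real c * C p q i j)"
| cong: "mixed I r C \<Longrightarrow>
    (\<And>p q i j. p \<in> I \<Longrightarrow> q \<in> I \<Longrightarrow> i \<in> I \<Longrightarrow> j \<in> I \<Longrightarrow> C p q i j = D p q i j) \<Longrightarrow> mixed I r D"

text \<open>The tensor product is bilinear, so each factor can be treated by its own induction: here
  the left factor is a single automorphism and the induction runs over the right one;
  \<open>mixed_tensor\<close> then inducts over the left.\<close>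

lemma mixed_tensor_ad:
  assumes "mixed J s D" "unitary_on I U"
  shows "mixed (I \<times> J) s (\<lambda>p q i j. (cnj (U (fst i) (fst p)) * U (fst j) (fst q)) *
    D (snd p) (snd q) (snd i) (snd j))"
  using assms(1)
proof induction
  case (ad V)
  show ?case
    by (rule mixed.cong[OF mixed.ad[OF unitary_on_tensor[OF assms(2) ad]]]) simp
next
  case (add r C s D)
  show ?case
    by (rule mixed.cong[OF mixed.add[OF add.IH]]) (simp add: algebra_simps)
next
  case (scale r C c)
  show ?case
    by (rule mixed.cong[OF mixed.scale[OF scale.IH scale.hyps(2)]]) (simp add: algebra_simps)
next
  case (cong r C D)
  show ?case
    by (rule mixed.cong[OF cong.IH]) (auto simp: cong.hyps)
qed

lemma mixed_tensor:
  assumes "mixed I r C" "mixed J s D"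
  shows "mixed (I \<times> J) (r * s) (\<lambda>p q i j. C (fst p) (fst q) (fst i) (fst j) *
    D (snd p) (snd q) (snd i) (snd j))"
  using assms(1)
proof induction
  case (ad V)
  show ?case
    using mixed_tensor_ad[OF assms(2) ad] by simp
next
  case (add r C r' D)
  show ?case
    unfolding distrib_right by (rule mixed.cong[OF mixed.add[OF add.IH]]) simp
next
  case (scale r C c)
  show ?case
    unfolding mult.assoc by (rule mixed.cong[OF mixed.scale[OF scale.IH scale.hyps(2)]]) simp
next
  case (cong r C D)
  show ?case
    by (rule mixed.cong[OF cong.IH]) (auto simp: cong.hyps)
qed

lemma mixed_reindex:
  assumes "mixed I r C" and f: "bij_betw f J I"
  shows "mixed J r (\<lambda>p q i j. C (f p) (f q) (f i) (f j))"
  using assms(1)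
proof induction
  case (ad U)
  show ?case
    by (rule mixed.cong[OF mixed.ad[OF unitary_on_reindex[OF ad f]]]) simp
next
  case (add r C s D)
  show ?case
    by (rule mixed.add[OF add.IH])
next
  case (scale r C c)
  show ?case
    by (rule mixed.scale[OF scale.IH scale.hyps(2)])
next
  case (cong r C D)
  show ?case
    using f by (intro mixed.cong[OF cong.IH] cong.hyps) (auto simp: bij_betw_def)
qed

text \<open>Turns the inductive closure into the explicit finite family of weights and unitaries
  that \<open>in_conv_Aut\<close> asks for. With lists, a sum of maps becomes a
  concatenation.\<close>

lemma mixed_imp_list:
  assumes "mixed I r C"
  shows "\<exists>L. (\<forall>x\<in>set L. 0 \<le> fst x \<and> unitary_on I (snd x)) \<and> sum_list (map fst L) = r \<and>
    (\<forall>p\<in>I. \<forall>q\<in>I. \<forall>i\<in>I. \<forall>j\<in>I.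
       C p q i j = (\<Sum>x\<leftarrow>L. complex_of_real (fst x) * (cnj (snd x i p) * snd x j q)))"
  using assms
proof induction
  case (ad U)
  then show ?case by (intro exI[of _ "[(1, U)]"]) simp
next
  case (add r C s D)
  then obtain L M where
    L: "\<forall>x\<in>set L. 0 \<le> fst x \<and> unitary_on I (snd x)" "sum_list (map fst L) = r"
      "\<forall>p\<in>I. \<forall>q\<in>I. \<forall>i\<in>I. \<forall>j\<in>I.
        C p q i j = (\<Sum>x\<leftarrow>L. complex_of_real (fst x) * (cnj (snd x i p) * snd x j q))"
    and M: "\<forall>x\<in>set M. 0 \<le> fst x \<and> unitary_on I (snd x)" "sum_list (map fst M) = s"
      "\<forall>p\<in>I. \<forall>q\<in>I. \<forall>i\<in>I. \<forall>j\<in>I.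
        D p q i j = (\<Sum>x\<leftarrow>M. complex_of_real (fst x) * (cnj (snd x i p) * snd x j q))"
    by blast
  show ?case
    using L M by (intro exI[of _ "L @ M"]) auto
next
  case (scale r C c)
  then obtain L where
    L: "\<forall>x\<in>set L. 0 \<le> fst x \<and> unitary_on I (snd x)" "sum_list (map fst L) = r"
      "\<forall>p\<in>I. \<forall>q\<in>I. \<forall>i\<in>I. \<forall>j\<in>I.
        C p q i j = (\<Sum>x\<leftarrow>L. complex_of_real (fst x) * (cnj (snd x i p) * snd x j q))"
    by blast
  show ?case
    using L scale.hyps(2)
    by (intro exI[of _ "map (\<lambda>x. (c * fst x, snd x)) L"])
      (auto simp: o_def sum_list_const_mult mult.assoc)
next
  case (cong r C D)
  then show ?case by auto
qed

lemma in_conv_AutI: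
  assumes "mixed {..<N} 1 C"
    and Phi: "\<And>X. X \<in> carrier_mat N N \<Longrightarrow>
      Phi X = mat N N (\<lambda>(p, q). \<Sum>i<N. \<Sum>j<N. X $$ (i, j) * C p q i j)"
  shows "in_conv_Aut N Phi"
proof -
  obtain L where
    L: "\<forall>x\<in>set L. 0 \<le> fst x \<and> unitary_on {..<N} (snd x)" "sum_list (map fst L) = 1"
      "\<forall>p\<in>{..<N}. \<forall>q\<in>{..<N}. \<forall>i\<in>{..<N}. \<forall>j\<in>{..<N}.
        C p q i j = (\<Sum>x\<leftarrow>L. complex_of_real (fst x) * (cnj (snd x i p) * snd x j q))"
    using mixed_imp_list[OF assms(1)] by blast
  define P where "P n = fst (L ! n)" for n
  define V where "V n = snd (L ! n)" for n
  define U where "U n = mat N N (\<lambda>(i, j). V n i j)" for n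
  have pos: "0 \<le> P n" and V: "unitary_on {..<N} (V n)" if "n < length L" for n
    using L(1) that by (auto simp: P_def V_def)
  have sum1: "(\<Sum>n<length L. P n) = 1"
    using L(2) by (simp add: sum_list_sum_nth P_def atLeast0LessThan)
  have C: "C p q i j = (\<Sum>n<length L. complex_of_real (P n) * (cnj (V n i p) * V n j q))"
    if "p < N" "q < N" "i < N" "j < N" for p q i j
    using L(3) that by (simp add: sum_list_sum_nth P_def V_def atLeast0LessThan)
  have U: "unitary_mat N (U n)" if "n < length L" for n
    using V[OF that] unfolding unitary_mat_def unitary_on_def U_def adj_def
    by (auto simp: scalar_prod_def atLeast0LessThan intro!: eq_matI)
  have conj: "(adj (U n) * X * U n) $$ (p, q) =
      (\<Sum>i<N. \<Sum>j<N. X $$ (i, j) * (cnj (V n i p) * V n j q))"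
    if X: "X \<in> carrier_mat N N" and pq: "p < N" "q < N" for n X p q
  proof -
    have "(adj (U n) * X * U n) $$ (p, q) = (\<Sum>j<N. (\<Sum>i<N. cnj (V n i p) * X $$ (i, j)) * V n j q)"
      using X pq by (simp add: U_def adj_def scalar_prod_def atLeast0LessThan)
    also have "\<dots> = (\<Sum>j<N. \<Sum>i<N. X $$ (i, j) * (cnj (V n i p) * V n j q))"
      unfolding sum_distrib_right by (simp add: mult_ac)
    also have "\<dots> = (\<Sum>i<N. \<Sum>j<N. X $$ (i, j) * (cnj (V n i p) * V n j q))"
      by (rule sum.swap)
    finally show ?thesis .
  qed
  have "Phi X = mat N N (\<lambda>(p, q). \<Sum>n<length L. complex_of_real (P n) * (adj (U n) * X * U n) $$ (p, q))"
    if X: "X \<in> carrier_mat N N" for X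
  proof -
    have "(\<Sum>i<N. \<Sum>j<N. X $$ (i, j) * C p q i j) =
        (\<Sum>n<length L. complex_of_real (P n) * (adj (U n) * X * U n) $$ (p, q))"
      if pq: "p < N" "q < N" for p q
    proof -
      have "(\<Sum>i<N. \<Sum>j<N. X $$ (i, j) * C p q i j) =
          (\<Sum>i<N. \<Sum>j<N. \<Sum>n<length L. complex_of_real (P n) * (X $$ (i, j) * (cnj (V n i p) * V n j q)))"
        using pq by (intro sum.cong refl) (simp add: C sum_distrib_left algebra_simps)
      also have "\<dots> = (\<Sum>i<N. \<Sum>n<length L. \<Sum>j<N. complex_of_real (P n) * (X $$ (i, j) * (cnj (V n i p) * V n j q)))"
        by (intro sum.cong refl sum.swap)
      also have "\<dots> = (\<Sum>n<length L. \<Sum>i<N. \<Sum>j<N. complex_of_real (P n) * (X $$ (i, j) * (cnj (V n i p) * V n j q)))"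
        by (rule sum.swap)
      also have "\<dots> = (\<Sum>n<length L. complex_of_real (P n) * (adj (U n) * X * U n) $$ (p, q))"
        using conj[OF X pq] by (simp add: sum_distrib_left)
      finally show ?thesis .
    qed
    then show ?thesis unfolding Phi[OF X] by (intro eq_matI) auto
  qed
  with pos U sum1 show ?thesis
    unfolding in_conv_Aut_def by blast
qed

lemma mixed_sum:
  assumes "finite A" "A \<noteq> {}" "\<And>a. a \<in> A \<Longrightarrow> mixed I (r a) (C a)"
  shows "mixed I (\<Sum>a\<in>A. r a) (\<lambda>p q i j. \<Sum>a\<in>A. C a p q i j)"
  using assms
proof (induction A rule: finite_ne_induct)
  case (singleton a)
  then show ?case by simp
next
  case (insert a A)
  then show ?case by (simp add: mixed.add)
qed

lemma mixed_average:
  assumes "finite A" "A \<noteq> {}" "\<And>a. a \<in> A \<Longrightarrow> mixed I r (C a)"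
  shows "mixed I r (\<lambda>p q i j. (\<Sum>a\<in>A. C a p q i j) / of_nat (card A))"
proof -
  have "mixed I ((1 / real (card A)) * (\<Sum>a\<in>A. r))
      (\<lambda>p q i j. complex_of_real (1 / real (card A)) * (\<Sum>a\<in>A. C a p q i j))"
    by (intro mixed.scale mixed_sum assms) auto
  moreover have "(1 / real (card A)) * (\<Sum>a\<in>A. r) = r"
    using assms(1,2) by simp
  ultimately show ?thesis by simp
qed

lemma mixed_convex:
  assumes "mixed I r C" "mixed I r D" "0 \<le> c" "c \<le> 1"
  shows "mixed I r (\<lambda>p q i j. complex_of_real c * C p q i j + complex_of_real (1 - c) * D p q i j)"
proof -
  have "mixed I (c * r + (1 - c) * r)
      (\<lambda>p q i j. complex_of_real c * C p q i j + complex_of_real (1 - c) * D p q i j)"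
    using assms by (intro mixed.add mixed.scale) auto
  then show ?thesis by (simp add: algebra_simps)
qed

subsection \<open>Twirling one tensor factor\<close>

text \<open>The effect on a kernel of replacing \<open>U\<close> by \<open>(1 \<otimes> g) U (1 \<otimes> g\<^sup>t)\<close>.\<close>

definition site :: "(nat \<Rightarrow> nat \<Rightarrow> complex) \<Rightarrow> (nat \<Rightarrow> nat \<Rightarrow> nat \<Rightarrow> nat \<Rightarrow> complex) \<Rightarrow>
    nat \<Rightarrow> nat \<Rightarrow> nat \<Rightarrow> nat \<Rightarrow> complex" where
  "site g c p q i j = (\<Sum>i'<3. \<Sum>p'<3. \<Sum>j'<3. \<Sum>q'<3.
     cnj (g i i') * cnj (g p p') * g j j' * g q q' * c p' q' i' j')"

text \<open>The \<open>'a\<close> coordinates enter only as parameters, so a transformation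
  \<open>f\<close> of kernels on one factor acts on the last tensor factor.\<close>

definition on_last :: "((nat \<Rightarrow> nat \<Rightarrow> nat \<Rightarrow> nat \<Rightarrow> complex) \<Rightarrow> nat \<Rightarrow> nat \<Rightarrow> nat \<Rightarrow> nat \<Rightarrow> complex) \<Rightarrow>
    ('a \<times> nat \<Rightarrow> 'a \<times> nat \<Rightarrow> 'a \<times> nat \<Rightarrow> 'a \<times> nat \<Rightarrow> complex) \<Rightarrow>
    'a \<times> nat \<Rightarrow> 'a \<times> nat \<Rightarrow> 'a \<times> nat \<Rightarrow> 'a \<times> nat \<Rightarrow> complex" where
  "on_last f C = (\<lambda>x y u v. f (\<lambda>p q i j. C (fst x, p) (fst y, q) (fst u, i) (fst v, j))
     (snd x) (snd y) (snd u) (snd v))"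

text \<open>The matrix is the product of \<open>G\<close>, \<open>U\<close> and the transpose of
  \<open>G\<close>, where \<open>G\<close> is 1 \<otimes> g.\<close>

lemma unitary_on_site:
  assumes U: "unitary_on (I \<times> {..<3::nat}) U" and g: "unitary_on {..<3} g"
  shows "unitary_on (I \<times> {..<3})
    (\<lambda>u x. \<Sum>i<3. \<Sum>p<3. g (snd u) i * g (snd x) p * U (fst u, i) (fst x, p))"
proof -
  have "finite (I \<times> {..<3::nat})"
    using U by (simp add: unitary_on_def)
  then have fin: "finite I"
    by (rule finite_cartesian_productD1) (simp add: lessThan_empty_iff)
  define G where "G = (\<lambda>u v. of_bool (fst u = (fst v :: 'a)) * g (snd u) (snd v))"
  have G: "unitary_on (I \<times> {..<3}) G"
    unfolding G_def by (rule unitary_on_tensor[OF unitary_on_id[OF fin] g])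
  have sum_G: "(\<Sum>k\<in>I \<times> {..<3}. G u k * f k) = (\<Sum>i<3. g (snd u) i * f (fst u, i))"
    if "u \<in> I \<times> {..<3}" for u f
  proof -
    have "(\<Sum>k\<in>I \<times> {..<3}. G u k * f k) =
        (\<Sum>v\<in>I. \<Sum>i<3. if v = fst u then g (snd u) i * f (v, i) else 0)"
      by (auto simp: sum.cartesian_product G_def intro!: sum.cong)
    also have "\<dots> = (\<Sum>v\<in>I. if v = fst u then \<Sum>i<3. g (snd u) i * f (v, i) else 0)"
      by (intro sum.cong) auto
    finally show ?thesis using fin that by auto
  qed
  have "unitary_on (I \<times> {..<3})
      (\<lambda>u x. \<Sum>k\<in>I \<times> {..<3}. (\<Sum>m\<in>I \<times> {..<3}. G u m * U m k) * G x k)"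
    by (rule unitary_on_mult[OF unitary_on_mult[OF G U] unitary_on_transpose[OF G]])
  then show ?thesis
  proof (rule unitary_on_cong)
    fix u x assume ux: "u \<in> I \<times> {..<3::nat}" "x \<in> I \<times> {..<3::nat}"
    have "(\<Sum>k\<in>I \<times> {..<3}. (\<Sum>m\<in>I \<times> {..<3}. G u m * U m k) * G x k) =
        (\<Sum>k\<in>I \<times> {..<3}. G x k * (\<Sum>i<3. g (snd u) i * U (fst u, i) k))"
      by (simp add: sum_G[OF ux(1)] mult.commute)
    also have "\<dots> = (\<Sum>p<3. g (snd x) p * (\<Sum>i<3. g (snd u) i * U (fst u, i) (fst x, p)))"
      by (rule sum_G[OF ux(2)])
    also have "\<dots> = (\<Sum>p<3. \<Sum>i<3. g (snd u) i * g (snd x) p * U (fst u, i) (fst x, p))"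
      unfolding sum_distrib_left by (simp add: mult_ac)
    also have "\<dots> = (\<Sum>i<3. \<Sum>p<3. g (snd u) i * g (snd x) p * U (fst u, i) (fst x, p))"
      by (rule sum.swap)
    finally show "(\<Sum>k\<in>I \<times> {..<3}. (\<Sum>m\<in>I \<times> {..<3}. G u m * U m k) * G x k) =
        (\<Sum>i<3. \<Sum>p<3. g (snd u) i * g (snd x) p * U (fst u, i) (fst x, p))" .
  qed
qed

lemma mixed_site:
  assumes "mixed (I \<times> {..<3}) r C" and g: "unitary_on {..<3} g"
  shows "mixed (I \<times> {..<3}) r (on_last (site g) C)"
  using assms(1)
proof induction
  case (ad U)
  show ?case
  proof (rule mixed.cong[OF mixed.ad[OF unitary_on_site[OF ad g]]])
    show "cnj (\<Sum>i'<3. \<Sum>p'<3. g (snd i) i' * g (snd p) p' * U (fst i, i') (fst p, p')) *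
        (\<Sum>i'<3. \<Sum>p'<3. g (snd j) i' * g (snd q) p' * U (fst j, i') (fst q, p')) =
        on_last (site g) (\<lambda>p q i j. cnj (U i p) * U j q) p q i j" for p q i j
      unfolding on_last_def site_def cnj_sum complex_cnj_mult sum_distrib_right
      unfolding sum_distrib_left by (simp add: mult_ac)
  qed
next
  case (add r C s D)
  show ?case
    by (rule mixed.cong[OF mixed.add[OF add.IH]])
      (simp add: on_last_def site_def ring_distribs sum.distrib)
next
  case (scale r C c)
  show ?case
    by (rule mixed.cong[OF mixed.scale[OF scale.IH scale.hyps(2)]])
      (simp add: on_last_def site_def sum_distrib_left mult_ac)
next
  case (cong r C D)
  show ?case
    by (rule mixed.cong[OF cong.IH]) (auto simp: on_last_def site_def cong.hyps)
qed

lemma site_monomial: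
  assumes "\<And>i. i < 3 \<Longrightarrow> f i < 3" "p < 3" "q < 3" "i < 3" "j < 3"
  shows "site (\<lambda>i j. if j = f i then z i else 0) c p q i j =
    cnj (z i) * cnj (z p) * z j * z q * c (f p) (f q) (f i) (f j)"
proof -
  have "site (\<lambda>i j. if j = f i then z i else 0) c p q i j =
    (\<Sum>i'<3. \<Sum>p'<3. \<Sum>j'<3. \<Sum>q'<3. if q' = f q then if j' = f j then if p' = f p then if i' = f i then
       cnj (z i) * cnj (z p) * z j * z q * c p' q' i' j' else 0 else 0 else 0 else 0)"
    unfolding site_def by (intro sum.cong refl) auto
  then show ?thesis
    by (simp add: assms)
qed

section \<open>Cube roots of unity and averaging over diagonal phases\<close>

definition omega :: complex where
  "omega = Complex (- 1 / 2) (sqrt 3 / 2)"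

lemma cnj_omega: "cnj omega = - 1 - omega"
  by (simp add: omega_def complex_eq_iff)

lemma omega_square: "omega * omega = - 1 - omega"
  by (simp add: omega_def complex_eq_iff)

text \<open>The form of \<open>omega_square\<close> for right-nested products. Together with
  \<open>cnj_omega\<close> it lets the simplifier reduce polynomials in \<open>omega\<close> and its
  conjugate to the shape x + y * \<open>omega\<close>.\<close>

lemma omega_square_assoc: "omega * (omega * x) = - x - omega * x"
  by (metis mult.assoc omega_square left_diff_distrib mult_minus_left mult_1)

lemmas omega_simps = cnj_omega omega_square omega_square_assoc

lemma less_3_cases: "(n::nat) < 3 \<Longrightarrow> n = 0 \<or> n = 1 \<or> n = 2"
  by auto

lemma sum_lessThan_3: "(\<Sum>i<3. f i) = f 0 + f 1 + f (2::nat)" for f :: "nat \<Rightarrow> complex"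
  by (simp add: numeral_3_eq_3 numeral_2_eq_2)

text \<open>The pairs {i, p} and {j, q} agree as multisets; these are the kernel entries unaffected
  by every diagonal unitary.\<close>

definition balanced :: "nat \<Rightarrow> nat \<Rightarrow> nat \<Rightarrow> nat \<Rightarrow> bool" where
  "balanced p q i j \<longleftrightarrow> i = j \<and> p = q \<or> i = q \<and> p = j"

text \<open>The last diagonal entry is normalised to 1, since a common phase cancels in
  \<open>site\<close>.\<close>

definition phase :: "nat \<Rightarrow> nat \<Rightarrow> nat \<Rightarrow> complex" where
  "phase a b i = (if i = 0 then omega ^ a else if i = 1 then omega ^ b else 1)"

lemma omega_power_unit: "cnj (omega ^ n) * omega ^ n = 1"
proof -
  have "cnj omega * omega = 1"
    by (simp add: omega_simps algebra_simps)
  then show ?thesis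
    by (metis complex_cnj_power power_mult_distrib power_one)
qed

lemma phase_unit: "cnj (phase a b i) * phase a b i = 1"
  using omega_power_unit by (simp add: phase_def)

text \<open>The exponent of \<open>omega\<close> is linear in \<open>a\<close> and \<open>b\<close>;
  its coefficients count how often 0, respectively 1, occurs in {j, q} minus how often it occurs in
  {i, p}. They lie between -2 and 2, so they are divisible by 3 only if they vanish, which is why
  cube roots suffice.\<close>

lemma phase_orthogonality:
  assumes "p < 3" "q < 3" "i < 3" "j < 3"
  shows "(\<Sum>a<3. \<Sum>b<3. cnj (phase a b i) * cnj (phase a b p) * phase a b j * phase a b q) =
    (if balanced p q i j then 9 else 0)"
  using assms[THEN less_3_cases]
  by (elim disjE; simp add: sum_lessThan_3 phase_def balanced_def power2_eq_square omega_simps algebra_simps)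

lemma mixed_phase:
  assumes "mixed (I \<times> {..<3}) r C"
  shows "mixed (I \<times> {..<3}) r
    (on_last (\<lambda>c p q i j. if balanced p q i j then c p q i j else 0) C)"
proof -
  define g where "g = (\<lambda>(a, b) i j. if j = i then phase a b i else 0)"
  have "mixed (I \<times> {..<3}) r (on_last (site (g a)) C)" for a
    unfolding g_def case_prod_beta
    by (intro mixed_site[OF assms] unitary_on_monomial phase_unit) (auto simp: bij_betw_def)
  then have "mixed (I \<times> {..<3}) r (\<lambda>p q i j.
      (\<Sum>a\<in>{..<3::nat} \<times> {..<3::nat}. on_last (site (g a)) C p q i j) / of_nat (card ({..<3::nat} \<times> {..<3::nat})))"
    by (intro mixed_average) (auto simp: lessThan_empty_iff)
  then show ?thesis
  proof (rule mixed.cong)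
    fix p q i j assume "p \<in> I \<times> {..<3::nat}" "q \<in> I \<times> {..<3::nat}" "i \<in> I \<times> {..<3::nat}" "j \<in> I \<times> {..<3::nat}"
    then have lt: "snd p < 3" "snd q < 3" "snd i < 3" "snd j < 3" by auto
    have "(\<Sum>a\<in>{..<3::nat} \<times> {..<3::nat}. on_last (site (g a)) C p q i j) =
       (\<Sum>a<3. \<Sum>b<3. cnj (phase a b (snd i)) * cnj (phase a b (snd p)) * phase a b (snd j) * phase a b (snd q)) *
         C p q i j"
      unfolding sum.cartesian_product[symmetric] sum_distrib_right on_last_def g_def
      using lt by (simp add: site_monomial[where f = "\<lambda>i. i"] sum.cartesian_product case_prod_beta)
    also have "\<dots> = (if balanced (snd p) (snd q) (snd i) (snd j) then 9 else 0) * C p q i j"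
      unfolding phase_orthogonality[OF lt] ..
    finally show "(\<Sum>a\<in>{..<3::nat} \<times> {..<3::nat}. on_last (site (g a)) C p q i j) /
        of_nat (card ({..<3::nat} \<times> {..<3::nat})) =
      on_last (\<lambda>c p q i j. if balanced p q i j then c p q i j else 0) C p q i j"
      by (simp add: on_last_def)
  qed
qed

section \<open>Averaging over coordinate permutations\<close>

definition perm3 :: "nat \<Rightarrow> nat \<Rightarrow> nat" where
  "perm3 n i = [[0,1,2],[1,2,0],[2,0,1],[0,2,1],[2,1,0],[1,0,2]] ! n ! i"

lemma less_6_cases: "(n::nat) < 6 \<Longrightarrow> n = 0 \<or> n = 1 \<or> n = 2 \<or> n = 3 \<or> n = 4 \<or> n = 5"
  by auto

lemma sum_lessThan_6:
  "(\<Sum>i<6. f i) = f 0 + f 1 + f 2 + f 3 + f 4 + f (5::nat)" for f :: "nat \<Rightarrow> complex"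
  by (simp add: eval_nat_numeral)

lemma lessThan_3: "{..<3::nat} = {0, 1, 2}"
  by auto

lemma bij_perm3: "n < 6 \<Longrightarrow> bij_betw (perm3 n) {..<3} {..<3}"
  by (drule less_6_cases, elim disjE) (auto simp: bij_betw_def lessThan_3 perm3_def)

lemma mixed_permute:
  assumes "mixed (I \<times> {..<3}) r C"
  shows "mixed (I \<times> {..<3}) r (on_last (\<lambda>c p q i j.
    (\<Sum>n<6. c (perm3 n p) (perm3 n q) (perm3 n i) (perm3 n j)) / 6) C)"
proof -
  define g :: "nat \<Rightarrow> nat \<Rightarrow> nat \<Rightarrow> complex" where "g = (\<lambda>n i j. if j = perm3 n i then 1 else 0)"
  have "mixed (I \<times> {..<3}) r (on_last (site (g n)) C)" if "n \<in> {..<6}" for n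
    unfolding g_def using that
    by (intro mixed_site[OF assms] unitary_on_monomial bij_perm3) auto
  then have "mixed (I \<times> {..<3}) r (\<lambda>p q i j.
      (\<Sum>n<6. on_last (site (g n)) C p q i j) / of_nat (card {..<6::nat}))"
    by (intro mixed_average) (auto simp: lessThan_empty_iff)
  then show ?thesis
  proof (rule mixed.cong)
    fix p q i j assume "p \<in> I \<times> {..<3::nat}" "q \<in> I \<times> {..<3::nat}" "i \<in> I \<times> {..<3::nat}" "j \<in> I \<times> {..<3::nat}"
    then have lt: "snd p < 3" "snd q < 3" "snd i < 3" "snd j < 3" by auto
    have "perm3 n m < 3" if "n < 6" "m < 3" for n m
      using bij_betw_apply[OF bij_perm3[OF that(1)]] that(2) by simp
    then have "on_last (site (g n)) C p q i j = on_last (\<lambda>c p q i j.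
        c (perm3 n p) (perm3 n q) (perm3 n i) (perm3 n j)) C p q i j" if "n < 6" for n
      unfolding on_last_def g_def using lt that
      by (subst site_monomial) auto
    then show "(\<Sum>n<6. on_last (site (g n)) C p q i j) / of_nat (card {..<6::nat}) =
      on_last (\<lambda>c p q i j. (\<Sum>n<6. c (perm3 n p) (perm3 n q) (perm3 n i) (perm3 n j)) / 6) C p q i j"
      by (simp add: on_last_def)
  qed
qed

section \<open>The Fourier matrix, Werner kernels and the full twirl\<close>

text \<open>The Fourier matrix without normalisation: computations stay free of square roots, and
  \<open>site_dft3\<close> collects the four factors 1 / sqrt 3 into 1/9.\<close>

definition fourier3 :: "nat \<Rightarrow> nat \<Rightarrow> complex" where
  "fourier3 i j = omega ^ (i * j)"

definition dft3 :: "nat \<Rightarrow> nat \<Rightarrow> complex" where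
  "dft3 i j = fourier3 i j / complex_of_real (sqrt 3)"

lemma sqrt_3_square: "complex_of_real (sqrt 3) * complex_of_real (sqrt 3) = 3"
  by (simp flip: of_real_mult)

lemma unitary_on_dft3: "unitary_on {..<3} dft3"
  unfolding unitary_on_def lessThan_3
  by (simp add: dft3_def fourier3_def sqrt_3_square power2_eq_square eval_nat_numeral omega_simps algebra_simps
      flip: add_divide_distrib diff_divide_distrib)

text \<open>The kernel of \<open>W3plus\<close>; \<open>werner_asym\<close> is that of
  \<open>W3minus\<close>.\<close>

definition werner_sym :: "nat \<Rightarrow> nat \<Rightarrow> nat \<Rightarrow> nat \<Rightarrow> complex" where
  "werner_sym p q i j = (of_bool (i = j \<and> p = q) + of_bool (p = j \<and> q = i)) / 4"

definition werner_asym :: "nat \<Rightarrow> nat \<Rightarrow> nat \<Rightarrow> nat \<Rightarrow> complex" where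
  "werner_asym p q i j = (of_bool (i = j \<and> p = q) - of_bool (p = j \<and> q = i)) / 2"

text \<open>For the kernel \<open>cnj (U i p) * U j q\<close> this is one third of the squared
  Hilbert-Schmidt norm of the symmetric part of \<open>U\<close>; \<open>asym_part\<close> is the
  same for the antisymmetric part.\<close>

definition sym_part :: "(nat \<Rightarrow> nat \<Rightarrow> nat \<Rightarrow> nat \<Rightarrow> complex) \<Rightarrow> complex" where
  "sym_part c = (\<Sum>i<3. \<Sum>p<3. c p p i i + c p i i p) / 6"

definition asym_part :: "(nat \<Rightarrow> nat \<Rightarrow> nat \<Rightarrow> nat \<Rightarrow> complex) \<Rightarrow> complex" where
  "asym_part c = (\<Sum>i<3. \<Sum>p<3. c p p i i - c p i i p) / 6"

text \<open>The parameters are the values on the three orbits of balanced indices under simultaneous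
  permutation: all four equal, i = j different from p = q, and i = q different from p = j.\<close>

definition monomial_kernel :: "complex \<Rightarrow> complex \<Rightarrow> complex \<Rightarrow> nat \<Rightarrow> nat \<Rightarrow> nat \<Rightarrow> nat \<Rightarrow> complex" where
  "monomial_kernel x y z p q i j =
     (if i = j \<and> p = q then if i = p then x else y else if i = q \<and> p = j then z else 0)"

text \<open>Averaging over all permutations replaces each entry by the mean over its orbit; the
  orbits have 3, 6 and 6 elements.\<close>

lemma permute_balanced:
  fixes c :: "nat \<Rightarrow> nat \<Rightarrow> nat \<Rightarrow> nat \<Rightarrow> complex"
  assumes "p < 3" "q < 3" "i < 3" "j < 3"
  defines "d \<equiv> (\<lambda>p q i j. if balanced p q i j then c p q i j else (0::complex))"
  shows "(\<Sum>n<6. d (perm3 n p) (perm3 n q) (perm3 n i) (perm3 n j)) / 6 =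
    monomial_kernel ((\<Sum>i<3. c i i i i) / 3) ((\<Sum>i<3. \<Sum>p<3. if i = p then 0 else c p p i i) / 6)
      ((\<Sum>i<3. \<Sum>p<3. if i = p then 0 else c p i i p) / 6) p q i j"
  using assms(1-4)[THEN less_3_cases] unfolding d_def monomial_kernel_def
  by (elim disjE; simp add: sum_lessThan_3 sum_lessThan_6 balanced_def perm3_def eval_nat_numeral)

lemma fourier3_table:
  "fourier3 0 j = 1" "fourier3 j 0 = 1" "fourier3 (Suc 0) (Suc 0) = omega" "fourier3 (Suc 0) 2 = - 1 - omega"
  "fourier3 2 (Suc 0) = - 1 - omega" "fourier3 2 2 = omega"
  by (simp_all add: fourier3_def eval_nat_numeral omega_simps algebra_simps)

lemma site_dft3: "site dft3 c p q i j = site fourier3 c p q i j / 9"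
proof -
  have s: "sqrt 3 * (sqrt 3 * (sqrt 3 * sqrt 3)) = 9"
    by simp
  have "complex_of_real (sqrt 3) * (complex_of_real (sqrt 3) * (complex_of_real (sqrt 3) * complex_of_real (sqrt 3))) = 9"
    unfolding of_real_mult[symmetric] s by simp
  then show ?thesis
    unfolding site_def dft3_def sum_divide_distrib
    by (intro sum.cong refl) (simp add: mult_ac)
qed

text \<open>Only balanced entries are computed, as a further phase average removes the others. On
  these, x + y + z and y - z are preserved while x - y - z is multiplied by -1/3; the Werner kernels
  span the plane x = y + z.\<close>

lemma site_dft3_monomial_kernel:
  assumes "i < 3" "p < 3"
  shows "site dft3 (monomial_kernel x y z) p p i i =
      (if i = p then (x + 2 * y + 2 * z) / 3 else (x + 2 * y - z) / 3)" (is ?A)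
    and "site dft3 (monomial_kernel x y z) p i i p =
      (if i = p then (x + 2 * y + 2 * z) / 3 else (x + 2 * z - y) / 3)" (is ?B)
proof -
  show ?A
    using assms[THEN less_3_cases] unfolding site_dft3 unfolding site_def
    by (elim disjE; simp add: sum_lessThan_3 monomial_kernel_def fourier3_table;
      simp add: omega_simps algebra_simps)
  show ?B
    using assms[THEN less_3_cases] unfolding site_dft3 unfolding site_def
    by (elim disjE; simp add: sum_lessThan_3 monomial_kernel_def fourier3_table;
      simp add: omega_simps algebra_simps)
qed

text \<open>The kernels fixed by diagonal phases and permutations form the three-dimensional space of the
  \<open>monomial_kernel\<close>s, containing the span of \<open>werner_sym\<close> and \<open>werner_asym\<close> with codimension one.
  Conjugation by the Fourier matrix multiplies the complement by \<open>-1/3\<close>, so mixing it with weight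
  \<open>3/4\<close> against the identity annihilates that complement.\<close>

lemma mixed_twirl:
  assumes "mixed (I \<times> {..<3}) r C"
  shows "mixed (I \<times> {..<3}) r (on_last (\<lambda>c p q i j.
    werner_sym p q i j * sym_part c + werner_asym p q i j * asym_part c) C)"
proof -
  let ?bal = "\<lambda>c p q i j. if balanced p q i j then c p q i j else (0::complex)"
  define x where "x c = (\<Sum>i<3. c i i i i) / 3" for c :: "nat \<Rightarrow> nat \<Rightarrow> nat \<Rightarrow> nat \<Rightarrow> complex"
  define y where "y c = (\<Sum>i<3. \<Sum>p<3. if i = p then 0 else c p p i i) / 6"
    for c :: "nat \<Rightarrow> nat \<Rightarrow> nat \<Rightarrow> nat \<Rightarrow> complex"
  define z where "z c = (\<Sum>i<3. \<Sum>p<3. if i = p then 0 else c p i i p) / 6"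
    for c :: "nat \<Rightarrow> nat \<Rightarrow> nat \<Rightarrow> nat \<Rightarrow> complex"
  let ?D = "on_last (\<lambda>c. monomial_kernel (x c) (y c) (z c)) C"
  have D: "mixed (I \<times> {..<3}) r ?D"
  proof (rule mixed.cong[OF mixed_permute[OF mixed_phase[OF assms]]])
    fix p q i j assume "p \<in> I \<times> {..<3::nat}" "q \<in> I \<times> {..<3::nat}" "i \<in> I \<times> {..<3::nat}" "j \<in> I \<times> {..<3::nat}"
    then have "snd p < 3" "snd q < 3" "snd i < 3" "snd j < 3" by auto
    note eq = permute_balanced[OF this, where c = "\<lambda>p' q' i' j'. C (fst p, p') (fst q, q') (fst i, i') (fst j, j')"]
    show "on_last (\<lambda>c p q i j. (\<Sum>n<6. c (perm3 n p) (perm3 n q) (perm3 n i) (perm3 n j)) / 6)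
        (on_last ?bal C) p q i j = ?D p q i j"
      unfolding on_last_def x_def y_def z_def fst_conv snd_conv by (rule eq)
  qed
  have "mixed (I \<times> {..<3}) r (\<lambda>p q i j. complex_of_real (1/4) * ?D p q i j +
      complex_of_real (1 - 1/4) * on_last ?bal (on_last (site dft3) ?D) p q i j)"
    by (intro mixed_convex mixed_phase mixed_site D unitary_on_dft3) auto
  then show ?thesis
  proof (rule mixed.cong)
    fix p q i j assume "p \<in> I \<times> {..<3::nat}" "q \<in> I \<times> {..<3::nat}" "i \<in> I \<times> {..<3::nat}" "j \<in> I \<times> {..<3::nat}"
    then have lt: "snd p < 3" "snd q < 3" "snd i < 3" "snd j < 3" by auto
    have parts: "sym_part c = x c + y c + z c"
      "asym_part c = y c - z c" for c
      by (simp_all add: sym_part_def asym_part_def x_def y_def z_def sum_lessThan_3 field_simps)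
    have pointwise: "complex_of_real (1/4) * monomial_kernel (x c) (y c) (z c) p q i j + complex_of_real (1 - 1/4) *
        ?bal (site dft3 (monomial_kernel (x c) (y c) (z c))) p q i j =
        werner_sym p q i j * sym_part c + werner_asym p q i j * asym_part c"
      if "p < 3" "q < 3" "i < 3" "j < 3" for c p q i j
    proof (cases "balanced p q i j")
      case True
      then consider "j = i" "q = p" | "q = i" "j = p" "i \<noteq> p" by (auto simp: balanced_def)
      then show ?thesis
        by cases (use that in \<open>simp_all add: site_dft3_monomial_kernel monomial_kernel_def balanced_def
          werner_sym_def werner_asym_def parts field_simps\<close>)
    next
      case False
      then have n: "(i = j \<and> p = q) = False" "(i = q \<and> p = j) = False" "(p = j \<and> q = i) = False"
        by (auto simp: balanced_def)
      show ?thesis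
        using False unfolding monomial_kernel_def werner_sym_def werner_asym_def n by simp
    qed
    show "complex_of_real (1/4) * ?D p q i j +
      complex_of_real (1 - 1/4) * on_last ?bal (on_last (site dft3) ?D) p q i j =
      on_last (\<lambda>c p q i j. werner_sym p q i j * sym_part c + werner_asym p q i j * asym_part c) C p q i j"
      unfolding on_last_def fst_conv snd_conv by (rule pointwise[OF lt])
  qed
qed

subsection \<open>One and two tensor factors\<close>

text \<open>A trivial first factor indexed by \<open>unit\<close> brings a single factor into the
  product form of \<open>mixed_twirl\<close>.\<close>

lemma mixed_twirl_single:
  assumes "mixed {..<3} r C"
  shows "mixed {..<3} r (\<lambda>p q i j. werner_sym p q i j * sym_part C + werner_asym p q i j * asym_part C)"
proof -
  have 1: "bij_betw snd ({()} \<times> {..<3::nat}) {..<3}"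
    by (auto simp: bij_betw_def inj_on_def image_iff)
  have 2: "bij_betw (Pair ()) {..<3::nat} ({()} \<times> {..<3})"
    by (auto simp: bij_betw_def inj_on_def)
  show ?thesis
    using mixed_reindex[OF mixed_twirl[OF mixed_reindex[OF assms 1]] 2] by (simp add: on_last_def)
qed

text \<open>The identity matrix is symmetric, so its twirl has no antisymmetric component.\<close>

lemma mixed_werner_sym: "mixed {..<3} 1 werner_sym"
proof -
  have "mixed {..<3::nat} 1 (\<lambda>p q i j. cnj (of_bool (i = p)) * of_bool (j = q))"
    by (rule mixed.ad[OF unitary_on_id]) simp
  from mixed_twirl_single[OF this] show ?thesis
    by (simp add: sym_part_def asym_part_def sum_lessThan_3)
qed

text \<open>The unitary is an antisymmetric 2 by 2 block plus a diagonal entry 1: of its squared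
  norm 3, the symmetric part carries 1 and the antisymmetric part 2.\<close>

lemma mixed_werner_third:
  "mixed {..<3} 1 (\<lambda>p q i j. werner_sym p q i j / 3 + 2 * werner_asym p q i j / 3)"
proof -
  have "mixed {..<3} 1 (\<lambda>p q i j. cnj (if p = [1, 0, 2] ! i then [1, - 1, 1] ! i else 0) *
      (if q = [1, 0, 2] ! j then [1, - 1, 1] ! j else 0))"
    by (intro mixed.ad unitary_on_monomial) (auto simp: bij_betw_def lessThan_3)
  from mixed_twirl_single[OF this] show ?thesis
    by (simp add: sym_part_def asym_part_def sum_lessThan_3 mult.commute)
qed

lemma sym_part_linear:
  "sym_part (\<lambda>p q i j. x * A p q i j + y * B p q i j) = x * sym_part A + y * sym_part B"
  by (simp add: sym_part_def sum.distrib sum_distrib_left ring_distribs add_divide_distrib)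

lemma asym_part_linear:
  "asym_part (\<lambda>p q i j. x * A p q i j + y * B p q i j) = x * asym_part A + y * asym_part B"
  by (simp add: asym_part_def sum.distrib sum_subtractf sum_distrib_left ring_distribs
      add_divide_distrib diff_divide_distrib)

text \<open>The inner product of \<open>U\<close> with its partial transpose; \<open>b\<close> and \<open>c\<close> tell which of the two
  tensor factors are transposed.\<close>

definition overlap :: "(nat \<times> nat \<Rightarrow> nat \<times> nat \<Rightarrow> complex) \<Rightarrow> bool \<Rightarrow> bool \<Rightarrow> complex" where
  "overlap U b c = (\<Sum>i<3. \<Sum>p<3. \<Sum>i'<3. \<Sum>p'<3. cnj (U (i, i') (p, p')) *
     U (if b then p else i, if c then p' else i') (if b then i else p, if c then i' else p'))"

text \<open>The factors are twirled in turn, with swaps because \<open>mixed_twirl\<close> acts on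
  the last one. Each coefficient is one ninth of the squared norm of a component of \<open>U\<close>
  under the projections (1 \<plusminus> partial transposition) / 2 in both factors, whence the
  36.\<close>

lemma mixed_twirl_pair:
  assumes U: "unitary_on ({..<3} \<times> {..<3}) U"
  shows "mixed ({..<3} \<times> {..<3}) 1 (\<lambda>(p, p') (q, q') (i, i') (j, j').
    (overlap U False False + overlap U True False + overlap U False True + overlap U True True) / 36 *
      (werner_sym p q i j * werner_sym p' q' i' j') +
    (overlap U False False + overlap U True False - overlap U False True - overlap U True True) / 36 *
      (werner_sym p q i j * werner_asym p' q' i' j') +
    (overlap U False False - overlap U True False + overlap U False True - overlap U True True) / 36 *
      (werner_asym p q i j * werner_sym p' q' i' j') +
    (overlap U False False - overlap U True False - overlap U False True + overlap U True True) / 36 *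
      (werner_asym p q i j * werner_asym p' q' i' j'))"
proof -
  have swap: "bij_betw prod.swap ({..<3::nat} \<times> {..<3::nat}) ({..<3} \<times> {..<3})"
    by (auto simp: bij_betw_def inj_on_def)
  let ?C = "\<lambda>x y u v. cnj (U u x) * U v y"
  let ?S = "\<lambda>p q i j. sym_part (\<lambda>p' q' i' j'. ?C (p, p') (q, q') (i, i') (j, j'))"
  let ?A = "\<lambda>p q i j. asym_part (\<lambda>p' q' i' j'. ?C (p, p') (q, q') (i, i') (j, j'))"
  note mix = mixed_reindex[OF mixed_twirl[OF mixed_reindex[OF mixed_twirl[OF mixed.ad[OF U]] swap]] swap]
  have parts:
    "sym_part ?S = (overlap U False False + overlap U True False + overlap U False True + overlap U True True) / 36"
    "sym_part ?A = (overlap U False False + overlap U True False - overlap U False True - overlap U True True) / 36"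
    "asym_part ?S = (overlap U False False - overlap U True False + overlap U False True - overlap U True True) / 36"
    "asym_part ?A = (overlap U False False - overlap U True False - overlap U False True + overlap U True True) / 36"
    unfolding sym_part_def asym_part_def overlap_def
    by (simp_all add: sum.distrib sum_subtractf flip: sum_divide_distrib) (simp_all add: field_simps)
  show ?thesis
    by (rule mixed.cong[OF mix])
      (clarsimp simp: on_last_def sym_part_linear asym_part_linear parts; simp add: algebra_simps)
qed

section \<open>Two special unitaries on the tensor square\<close>

text \<open>This is 2 P - F, with P the projection onto the line of the maximally entangled vector
  and F the flip. It is 1 on that vector and on antisymmetric tensors, and -1 on the remaining
  symmetric tensors.\<close>

definition pair_reflection :: "nat \<times> nat \<Rightarrow> nat \<times> nat \<Rightarrow> complex" where
  "pair_reflection x y = 2 / 3 * of_bool (fst x = snd x \<and> fst y = snd y) - of_bool (fst x = snd y \<and> snd x = fst y)"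

text \<open>The matrix is real, symmetric and squares to 1.\<close>

lemma unitary_on_pair_reflection: "unitary_on ({..<3} \<times> {..<3}) pair_reflection"
proof -
  have "(\<Sum>k<3. \<Sum>k'<3. pair_reflection (i, i') (k, k') * pair_reflection (k, k') (j, j')) =
      of_bool (i = j \<and> i' = j')" if "i < 3" "i' < 3" "j < 3" "j' < 3" for i i' j j'
    using that[THEN less_3_cases]
    by (elim disjE; simp add: pair_reflection_def sum_lessThan_3)
  then have square: "(\<Sum>k\<in>{..<3} \<times> {..<3}. pair_reflection x k * pair_reflection k y) = of_bool (x = y)"
    if "x \<in> {..<3} \<times> {..<3}" "y \<in> {..<3} \<times> {..<3}" for x y
    using that by (auto simp: sum.cartesian_product')
  have sym: "pair_reflection x y = pair_reflection y x" for x y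
    unfolding pair_reflection_def
    by (intro arg_cong2[where f = minus] arg_cong[where f = "\<lambda>b. 2 / 3 * of_bool b"]
        arg_cong[where f = of_bool]) (blast, metis)
  have "cnj (of_bool b) = of_bool b" for b
    by (cases b) simp_all
  then have real: "cnj (pair_reflection x y) = pair_reflection x y" for x y
    by (simp only: pair_reflection_def complex_cnj_diff complex_cnj_mult complex_cnj_divide complex_cnj_numeral)
  have "(\<Sum>k\<in>{..<3} \<times> {..<3}. pair_reflection k x * pair_reflection k y) =
      (\<Sum>k\<in>{..<3} \<times> {..<3}. pair_reflection x k * pair_reflection k y)"
    "(\<Sum>k\<in>{..<3} \<times> {..<3}. pair_reflection x k * pair_reflection y k) =
      (\<Sum>k\<in>{..<3} \<times> {..<3}. pair_reflection x k * pair_reflection k y)" for x y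
    using sym by metis+
  then show ?thesis
    unfolding unitary_on_def real using square by simp
qed

text \<open>Partial transposition in either factor exchanges F and 3 P, which gives the overlap
  -23/3. The full transposition fixes 2 P - F, so the two mixed coefficients vanish.\<close>

lemma mixed_pair_reflection:
  "mixed ({..<3} \<times> {..<3}) 1 (\<lambda>(p, p') (q, q') (i, i') (j, j').
    2 / 27 * (werner_sym p q i j * werner_sym p' q' i' j') +
    25 / 27 * (werner_asym p q i j * werner_asym p' q' i' j'))"
proof -
  have "overlap pair_reflection False False = 9" "overlap pair_reflection True False = - 23 / 3"
    "overlap pair_reflection False True = - 23 / 3" "overlap pair_reflection True True = 9"
    by (simp_all add: overlap_def sum_lessThan_3 pair_reflection_def)
  with mixed_twirl_pair[OF unitary_on_pair_reflection] show ?thesis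
    by simp
qed

text \<open>The phases are chosen so that the entries of \<open>pair_monomial\<close> on each orbit of the two partial
  transpositions sum to zero (as \<open>1 + \<omega> + \<omega>\<^sup>2\<close>): its doubly symmetric part vanishes.\<close>

definition pair_perm :: "nat \<times> nat \<Rightarrow> nat \<times> nat" where
  "pair_perm x = [(2,2), (1,2), (1,1), (2,1), (2,0), (0,1), (0,2), (1,0), (0,0)] ! (3 * fst x + snd x)"

definition pair_phase :: "nat \<times> nat \<Rightarrow> complex" where
  "pair_phase x = omega ^ ([0, 0, 1, 1, 0, 2, 1, 2, 2] ! (3 * fst x + snd x))"

definition pair_monomial :: "nat \<times> nat \<Rightarrow> nat \<times> nat \<Rightarrow> complex" where
  "pair_monomial x y = (if y = pair_perm x then pair_phase x else 0)"

lemma bij_pair_perm: "bij_betw pair_perm ({..<3} \<times> {..<3}) ({..<3} \<times> {..<3})"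
proof -
  have S: "{..<3::nat} \<times> {..<3::nat} = {(0,0), (0,1), (0,2), (1,0), (1,1), (1,2), (2,0), (2,1), (2,2)}"
    by (auto simp: lessThan_3)
  have "pair_perm ` ({..<3} \<times> {..<3}) = {..<3} \<times> {..<3}"
    unfolding S by (simp add: pair_perm_def insert_commute)
  then show ?thesis
    by (simp add: bij_betw_def finite_surj_inj)
qed

lemma unitary_on_pair_monomial: "unitary_on ({..<3} \<times> {..<3}) pair_monomial"
  unfolding pair_monomial_def pair_phase_def
  by (intro unitary_on_monomial bij_pair_perm omega_power_unit) simp

text \<open>Each of the three orbits that meet the support contains the nonzero entries 1,
  \<open>omega\<close> and its square. Each nontrivial partial transposition exchanges one pair of
  them, contributing \<open>omega + cnj omega\<close>, that is -1, per orbit.\<close>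

lemma mixed_pair_monomial:
  "mixed ({..<3} \<times> {..<3}) 1 (\<lambda>(p, p') (q, q') (i, i') (j, j').
    (werner_sym p q i j * werner_asym p' q' i' j') / 3 +
    (werner_asym p q i j * werner_sym p' q' i' j') / 3 +
    (werner_asym p q i j * werner_asym p' q' i' j') / 3)"
proof -
  have "overlap pair_monomial False False = 9" "overlap pair_monomial True False = - 3"
    "overlap pair_monomial False True = - 3" "overlap pair_monomial True True = - 3"
    by (simp_all add: overlap_def sum_lessThan_3 pair_monomial_def pair_perm_def pair_phase_def
        power2_eq_square omega_simps algebra_simps)
  with mixed_twirl_pair[OF unitary_on_pair_monomial] show ?thesis
    by simp
qed

section \<open>Convex decompositions of the first three tensor powers\<close>

definition werner :: "real \<Rightarrow> nat \<Rightarrow> nat \<Rightarrow> nat \<Rightarrow> nat \<Rightarrow> complex" where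
  "werner l p q i j = complex_of_real l * werner_sym p q i j + complex_of_real (1 - l) * werner_asym p q i j"

lemma mixed_werner:
  assumes "1/3 \<le> l" "l \<le> 1"
  shows "mixed {..<3} 1 (werner l)"
proof -
  \<comment> \<open>The weight is 1 - l divided by 2/3, the antisymmetric coefficient in
    \<open>mixed_werner_third\<close>.\<close>
  have "mixed {..<3} 1 (\<lambda>p q i j.
      complex_of_real (3 * (1 - l) / 2) * (werner_sym p q i j / 3 + 2 * werner_asym p q i j / 3) +
      complex_of_real (1 - 3 * (1 - l) / 2) * werner_sym p q i j)"
    using assms by (intro mixed_convex mixed_werner_third mixed_werner_sym) auto
  then show ?thesis
    by (rule mixed.cong) (simp add: werner_def field_simps)
qed

lemma mixed_werner_pair:
  assumes "1/4 \<le> l" "l \<le> 1"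
  shows "mixed ({..<3} \<times> {..<3}) 1 (\<lambda>(p, p') (q, q') (i, i') (j, j'). werner l p q i j * werner l p' q' i' j')"
proof (cases "1/3 \<le> l")
  case True
  then show ?thesis
    by (intro mixed.cong[OF mixed_tensor[OF mixed_werner mixed_werner, unfolded mult_1, of l l]])
      (use assms in auto)
next
  case False
  \<comment> \<open>Comparing coefficients: the mixed terms give a/3 = l (1 - l), the doubly
    antisymmetric one a/3 + 25 b/27 = (1 - l)^2, and the doubly symmetric one 2 b/27 + c =
    l^2.\<close>
  define a b c where "a = 3 * l * (1 - l)" and "b = 27 / 25 * ((1 - l) * (1 - 2 * l))"
    and "c = l^2 - 2 / 25 * ((1 - l) * (1 - 2 * l))"
  have "0 \<le> a" "0 \<le> b"
    using assms False by (auto simp: a_def b_def)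
  \<comment> \<open>Both factors are largest at l = 1/4, where l^2 is smallest; hence c is at least
    1/16 - 3/100.\<close>
  moreover have "(1 - l) * (1 - 2 * l) \<le> 3/4 * (1/2)"
    using assms False by (intro mult_mono) auto
  moreover have "(1/4)^2 \<le> l^2"
    using assms by (intro power_mono) auto
  then have "1/16 \<le> l^2"
    by (simp add: power2_eq_square)
  ultimately have pos: "0 \<le> a" "0 \<le> b" "0 \<le> c"
    by (auto simp: c_def)
  have total: "a * 1 + b * 1 + c * (1 * 1) = 1"
    by (simp add: a_def b_def c_def power2_eq_square algebra_simps)
  have "mixed ({..<3} \<times> {..<3}) (a * 1 + b * 1 + c * (1 * 1))
    (\<lambda>p q i j. complex_of_real a * (\<lambda>(p, p') (q, q') (i, i') (j, j').
        (werner_sym p q i j * werner_asym p' q' i' j') / 3 +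
        (werner_asym p q i j * werner_sym p' q' i' j') / 3 +
        (werner_asym p q i j * werner_asym p' q' i' j') / 3) p q i j +
      complex_of_real b * (\<lambda>(p, p') (q, q') (i, i') (j, j').
        2 / 27 * (werner_sym p q i j * werner_sym p' q' i' j') +
        25 / 27 * (werner_asym p q i j * werner_asym p' q' i' j')) p q i j +
      complex_of_real c * (werner_sym (fst p) (fst q) (fst i) (fst j) * werner_sym (snd p) (snd q) (snd i) (snd j)))"
    by (intro mixed.add mixed.scale mixed_pair_monomial mixed_pair_reflection
        mixed_tensor mixed_werner_sym pos)
  then show ?thesis
    unfolding total
  proof (rule mixed.cong, clarsimp, goal_cases)
    case (1 p p' q q' i i' j j')
    have "complex_of_real a * (s * a' / 3 + a1 * s' / 3 + a1 * a' / 3) +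
       complex_of_real b * (2 * (s * s') / 27 + 25 * (a1 * a') / 27) + complex_of_real c * (s * s') =
       (complex_of_real l * s + complex_of_real (1 - l) * a1) * (complex_of_real l * s' + complex_of_real (1 - l) * a')"
      for s s' a1 a'
      by (simp add: a_def b_def c_def power2_eq_square field_simps)
    then show ?case
      unfolding werner_def .
  qed
qed

text \<open>The sum over the three positions of \<open>A\<close> is left undivided, hence the weight
  3.\<close>

lemma mixed_symmetrize:
  assumes A: "mixed I 1 A" and B: "mixed (I \<times> I) 1 B"
  shows "mixed (I \<times> I \<times> I) 3 (\<lambda>(p, p', p'') (q, q', q'') (i, i', i'') (j, j', j'').
    A p q i j * B (p', p'') (q', q'') (i', i'') (j', j'') +
    A p' q' i' j' * B (p, p'') (q, q'') (i, i'') (j, j'') +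
    A p'' q'' i'' j'' * B (p, p') (q, q') (i, i') (j, j'))"
proof -
  have f: "bij_betw (\<lambda>(x, y, z). (y, x, z)) (I \<times> I \<times> I) (I \<times> I \<times> I)"
    by (rule bij_betw_byWitness[where f' = "\<lambda>(x, y, z). (y, x, z)"]) auto
  have g: "bij_betw (\<lambda>(x, y, z). (z, x, y)) (I \<times> I \<times> I) (I \<times> I \<times> I)"
    by (rule bij_betw_byWitness[where f' = "\<lambda>(x, y, z). (y, z, x)"]) auto
  note AB = mixed_tensor[OF A B, unfolded mult_1]
  have three: "1 + 1 + 1 = (3::real)"
    by simp
  note mix = mixed.add[OF mixed.add[OF AB mixed_reindex[OF AB f]] mixed_reindex[OF AB g], unfolded three]
  show ?thesis
    by (rule mixed.cong[OF mix]) auto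
qed

lemma mixed_werner_triple:
  assumes "1/4 \<le> l" "l \<le> 1"
  shows "mixed ({..<3} \<times> {..<3} \<times> {..<3}) 1 (\<lambda>(p, p', p'') (q, q', q'') (i, i', i'') (j, j', j'').
    werner l p q i j * (werner l p' q' i' j' * werner l p'' q'' i'' j''))"
proof (cases "1/3 \<le> l")
  case True
  then show ?thesis
    by (intro mixed.cong[OF mixed_tensor[OF mixed_werner mixed_werner_pair, unfolded mult_1, of l l]])
      (use assms in auto)
next
  case False
  define m where "m = 1 - l"
  \<comment> \<open>The unique solution of the four linear equations obtained by comparing the coefficients of the
    products with 0, 1, 2 and 3 antisymmetric factors.\<close>
  define a b c d where "a = 3/308 * m * (300 * l * m - 46 * m^2 - 150 * l^2)"
    and "b = 27/154 * m * (4 * m^2 + 3 * l^2 - 6 * l * m)"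
    and "c = 1/2 * m * (3 * l^2 - m^2 + 23/77 * (4 * m^2 + 3 * l^2 - 6 * l * m))"
    and "d = l^3 - 1/77 * m * (4 * m^2 + 3 * l^2 - 6 * l * m)"
  \<comment> \<open>Measured from the left endpoint, \<open>t\<close> lies in a short interval.
    There the bound of t^2 by t/12 makes the quadratic sign conditions linear.\<close>
  define t where "t = l - 1/4"
  have l: "l = 1/4 + t" "m = 3/4 - t" and t: "0 \<le> t" "t \<le> 1/12"
    using assms False by (auto simp: t_def m_def)
  have t2: "0 \<le> t^2" "t^2 \<le> t / 12"
    using t mult_left_mono[OF t(2) t(1)] by (auto simp: power2_eq_square)
  have m: "0 \<le> m"
    using l t by simp
  have e: "300 * l * m - 46 * m^2 - 150 * l^2 = 21 + 144 * t - 496 * t^2"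
    "4 * m^2 + 3 * l^2 - 6 * l * m = 21/16 - 15/2 * t + 13 * t^2"
    unfolding l by (simp_all add: power2_eq_square field_simps)
  have e': "3 * l^2 - m^2 + 23/77 * (4 * m^2 + 3 * l^2 - 6 * l * m) = 3/176 + 117/154 * t + 453/77 * t^2"
    unfolding l by (simp add: power2_eq_square field_simps)
  have "0 \<le> 300 * l * m - 46 * m^2 - 150 * l^2" "0 \<le> 4 * m^2 + 3 * l^2 - 6 * l * m"
    using t t2 unfolding e by linarith+
  moreover have "0 \<le> 3 * l^2 - m^2 + 23/77 * (4 * m^2 + 3 * l^2 - 6 * l * m)"
    using t t2 unfolding e' by linarith
  moreover have "d = 1/352 + 171/616 * t + 81/154 * t^2 + 90/77 * t^3"
    unfolding d_def l by (simp add: power2_eq_square power3_eq_cube field_simps)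
  then have "0 \<le> d"
    using t by simp
  ultimately have pos: "0 \<le> a" "0 \<le> b" "0 \<le> c" "0 \<le> d"
    using m by (auto simp: a_def b_def c_def)
  have total: "a * 3 + b * 3 + c * 3 + d * (1 * (1 * 1)) = 1"
    unfolding a_def b_def c_def d_def m_def by (simp add: power2_eq_square power3_eq_cube field_simps)
  let ?third = "\<lambda>p q i j. werner_sym p q i j / 3 + 2 * werner_asym p q i j / 3"
  let ?V = "\<lambda>(p, p') (q, q') (i, i') (j, j').
        (werner_sym p q i j * werner_asym p' q' i' j') / 3 +
        (werner_asym p q i j * werner_sym p' q' i' j') / 3 +
        (werner_asym p q i j * werner_asym p' q' i' j') / 3"
  let ?K = "\<lambda>(p, p') (q, q') (i, i') (j, j').
        2 / 27 * (werner_sym p q i j * werner_sym p' q' i' j') +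
        25 / 27 * (werner_asym p q i j * werner_asym p' q' i' j')"
  let ?sym = "\<lambda>A B. \<lambda>(p, p', p'') (q, q', q'') (i, i', i'') (j, j', j'').
    A p q i j * B (p', p'') (q', q'') (i', i'') (j', j'') +
    A p' q' i' j' * B (p, p'') (q, q'') (i, i'') (j, j'') +
    A p'' q'' i'' j'' * B (p, p') (q, q') (i, i') (j, j')"
  have "mixed ({..<3} \<times> {..<3} \<times> {..<3}) (a * 3 + b * 3 + c * 3 + d * (1 * (1 * 1)))
    (\<lambda>p q i j. complex_of_real a * ?sym ?third ?V p q i j +
      complex_of_real b * ?sym ?third ?K p q i j +
      complex_of_real c * ?sym werner_sym ?V p q i j +
      complex_of_real d * (werner_sym (fst p) (fst q) (fst i) (fst j) *
       (werner_sym (fst (snd p)) (fst (snd q)) (fst (snd i)) (fst (snd j)) *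
        werner_sym (snd (snd p)) (snd (snd q)) (snd (snd i)) (snd (snd j)))))"
    by (intro mixed.add mixed.scale mixed_symmetrize mixed_pair_monomial mixed_pair_reflection
        mixed_tensor[where C = werner_sym] mixed_tensor[where C = werner_sym and D = werner_sym]
        mixed_werner_sym mixed_werner_third pos)
  then show ?thesis
    unfolding total
  proof (rule mixed.cong, clarsimp, goal_cases)
    case (1 p p' p'' q q' q'' i i' i'' j j' j'')
    \<comment> \<open>The kernel values are replaced by arbitrary complex numbers, leaving a
      polynomial identity that is sorted by the number of antisymmetric factors.\<close>
    have "complex_of_real a *
       ((s1 / 3 + 2 * a1 / 3) * (s2 * a3 / 3 + a2 * s3 / 3 + a2 * a3 / 3) +
        (s2 / 3 + 2 * a2 / 3) * (s1 * a3 / 3 + a1 * s3 / 3 + a1 * a3 / 3) +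
        (s3 / 3 + 2 * a3 / 3) * (s1 * a2 / 3 + a1 * s2 / 3 + a1 * a2 / 3)) +
       complex_of_real b *
       ((s1 / 3 + 2 * a1 / 3) * (2 * (s2 * s3) / 27 + 25 * (a2 * a3) / 27) +
        (s2 / 3 + 2 * a2 / 3) * (2 * (s1 * s3) / 27 + 25 * (a1 * a3) / 27) +
        (s3 / 3 + 2 * a3 / 3) * (2 * (s1 * s2) / 27 + 25 * (a1 * a2) / 27)) +
       complex_of_real c *
       (s1 * (s2 * a3 / 3 + a2 * s3 / 3 + a2 * a3 / 3) +
        s2 * (s1 * a3 / 3 + a1 * s3 / 3 + a1 * a3 / 3) +
        s3 * (s1 * a2 / 3 + a1 * s2 / 3 + a1 * a2 / 3)) +
       complex_of_real d * (s1 * (s2 * s3)) =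
       (complex_of_real l * s1 + complex_of_real (1 - l) * a1) *
       ((complex_of_real l * s2 + complex_of_real (1 - l) * a2) *
        (complex_of_real l * s3 + complex_of_real (1 - l) * a3))" (is "?L = ?R")
      for s1 s2 s3 a1 a2 a3
    proof -
      have "2 / 27 * b + d = l^3" "2/9 * a + 4/81 * b + 2/3 * c = l^2 * m"
        "5/9 * a + 25/81 * b + 1/3 * c = l * m^2" "2/3 * a + 50/27 * b = m^3"
        unfolding a_def b_def c_def d_def m_def by (simp_all add: power2_eq_square power3_eq_cube field_simps)
      from this[THEN arg_cong[where f = complex_of_real]]
      have eqs: "2 / 27 * complex_of_real b + complex_of_real d = complex_of_real l ^ 3"
        "2/9 * complex_of_real a + 4/81 * complex_of_real b + 2/3 * complex_of_real c = complex_of_real l ^ 2 * complex_of_real m"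
        "5/9 * complex_of_real a + 25/81 * complex_of_real b + 1/3 * complex_of_real c = complex_of_real l * complex_of_real m ^ 2"
        "2/3 * complex_of_real a + 50/27 * complex_of_real b = complex_of_real m ^ 3"
        by simp_all
      have "?L = (2 / 27 * complex_of_real b + complex_of_real d) * (s1 * s2 * s3) +
        (2/9 * complex_of_real a + 4/81 * complex_of_real b + 2/3 * complex_of_real c) *
          (s1 * s2 * a3 + s1 * a2 * s3 + a1 * s2 * s3) +
        (5/9 * complex_of_real a + 25/81 * complex_of_real b + 1/3 * complex_of_real c) *
          (s1 * a2 * a3 + a1 * s2 * a3 + a1 * a2 * s3) +
        (2/3 * complex_of_real a + 50/27 * complex_of_real b) * (a1 * a2 * a3)"
        by (simp add: field_simps)
      also have "\<dots> = ?R"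
        unfolding eqs m_def[symmetric] by (simp add: power2_eq_square power3_eq_cube algebra_simps)
      finally show ?thesis .
    qed
    then show ?case
      unfolding werner_def .
  qed
qed

subsection \<open>Tensor powers\<close>

text \<open>Indices are read in base 3 with the last factor as lowest digit, in keeping with
  \<open>i * b + k\<close> in \<open>kron\<close>. The value 1 at exponent 0 is the identity on 1 by
  1 matrices.\<close>

primrec power_kernel :: "real \<Rightarrow> nat \<Rightarrow> nat \<Rightarrow> nat \<Rightarrow> nat \<Rightarrow> nat \<Rightarrow> complex" where
  "power_kernel l 0 p q i j = 1"
| "power_kernel l (Suc k) p q i j = power_kernel l k (p div 3) (q div 3) (i div 3) (j div 3) *
     werner l (p mod 3) (q mod 3) (i mod 3) (j mod 3)"

lemma T_lam_munit:
  assumes "p < 3" "q < 3" "i < 3" "j < 3"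
  shows "T_lam l (munit 3 i j) $$ (p, q) = werner l p q i j"
proof -
  have "mtrace (munit 3 i j) = (\<Sum>a<3. if a = i then of_bool (i = j) else 0)"
    unfolding mtrace_def munit_def dim_row_mat by (intro sum.cong) (use assms in auto)
  also have "\<dots> = of_bool (i = j)"
    using assms by simp
  finally show ?thesis
    using assms unfolding T_lam_def W3plus_def W3minus_def werner_def werner_sym_def werner_asym_def
    by (auto simp: munit_def)
qed

lemma dim_T_lam_munit: "dim_row (T_lam l (munit 3 i j)) = 3" "dim_col (T_lam l (munit 3 i j)) = 3"
  by (simp_all add: T_lam_def W3minus_def munit_def)

lemma sum_div_mod_3:
  fixes f :: "nat \<Rightarrow> complex"
  shows "(\<Sum>i<a. \<Sum>k<3. f (i * 3 + k)) = (\<Sum>n<a * 3. f n)"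
  by (induction a) (simp_all add: sum_lessThan_3 add.commute eval_nat_numeral)

lemma tensor_pow_T_lam:
  assumes "X \<in> carrier_mat (3 ^ k) (3 ^ k)"
  shows "tensor_pow 3 (T_lam l) k X =
    mat (3 ^ k) (3 ^ k) (\<lambda>(p, q). \<Sum>i<3 ^ k. \<Sum>j<3 ^ k. X $$ (i, j) * power_kernel l k p q i j)"
  using assms
proof (induction k arbitrary: X)
  case 0
  then show ?case by (intro eq_matI) auto
next
  case (Suc k)
  let ?n = "3 ^ k :: nat"
  \<comment> \<open>\<open>tensor_map\<close> evaluates its arguments only at matrix units, where
    the induction hypothesis returns the kernel itself.\<close>
  have IH: "tensor_pow 3 (T_lam l) k (munit ?n i j) = mat ?n ?n (\<lambda>(p, q). power_kernel l k p q i j)"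
    if "i < ?n" "j < ?n" for i j
  proof -
    have "(\<Sum>i'<?n. \<Sum>j'<?n. munit ?n i j $$ (i', j') * power_kernel l k p q i' j') = power_kernel l k p q i j" for p q
    proof -
      have "(\<Sum>i'<?n. \<Sum>j'<?n. munit ?n i j $$ (i', j') * power_kernel l k p q i' j') =
          (\<Sum>i'<?n. \<Sum>j'<?n. if j' = j then if i' = i then power_kernel l k p q i' j' else 0 else 0)"
        by (intro sum.cong refl) (auto simp: munit_def)
      then show ?thesis using that by simp
    qed
    then show ?thesis
      by (subst Suc.IH) (auto simp: munit_def)
  qed
  show ?case
  proof (intro eq_matI)
    fix p q
    assume "p < dim_row (mat (3 ^ Suc k) (3 ^ Suc k) (\<lambda>(p, q). \<Sum>i<3 ^ Suc k. \<Sum>j<3 ^ Suc k. X $$ (i, j) * power_kernel l (Suc k) p q i j))"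
      and "q < dim_col (mat (3 ^ Suc k) (3 ^ Suc k) (\<lambda>(p, q). \<Sum>i<3 ^ Suc k. \<Sum>j<3 ^ Suc k. X $$ (i, j) * power_kernel l (Suc k) p q i j))"
    then have pq: "p < ?n * 3" "q < ?n * 3" by auto
    then have pq': "p div 3 < ?n" "q div 3 < ?n"
      by (auto intro: less_mult_imp_div_less)
    have entry: "kron (tensor_pow 3 (T_lam l) k (munit ?n i j)) (T_lam l (munit 3 i' j')) $$ (p, q) =
        power_kernel l (Suc k) p q (i * 3 + i') (j * 3 + j')"
      if "i < ?n" "j < ?n" "i' < 3" "j' < 3" for i j i' j'
      using pq pq' that unfolding IH[OF that(1,2)] kron_def
      by (simp add: dim_T_lam_munit T_lam_munit)
    have "tensor_pow 3 (T_lam l) (Suc k) X $$ (p, q) =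
        (\<Sum>i<?n. \<Sum>j<?n. \<Sum>i'<3. \<Sum>j'<3. X $$ (i * 3 + i', j * 3 + j') *
          power_kernel l (Suc k) p q (i * 3 + i') (j * 3 + j'))"
      using pq by (simp add: tensor_map_def entry del: power_kernel.simps)
    \<comment> \<open>The middle sums are swapped so that each index stands next to its last digit
      and both pairs can be merged.\<close>
    also have "\<dots> = (\<Sum>i<?n. \<Sum>i'<3. \<Sum>j<?n. \<Sum>j'<3. X $$ (i * 3 + i', j * 3 + j') *
          power_kernel l (Suc k) p q (i * 3 + i') (j * 3 + j'))"
      by (intro sum.cong refl sum.swap)
    also have "\<dots> = (\<Sum>i<?n * 3. \<Sum>j<?n * 3. X $$ (i, j) * power_kernel l (Suc k) p q i j)"
      unfolding sum_div_mod_3[where f = "\<lambda>j. X $$ (r, j) * power_kernel l (Suc k) p q r j" for r]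
      by (rule sum_div_mod_3[where f = "\<lambda>i. \<Sum>j<?n * 3. X $$ (i, j) * power_kernel l (Suc k) p q i j"])
    finally show "tensor_pow 3 (T_lam l) (Suc k) X $$ (p, q) =
        mat (3 ^ Suc k) (3 ^ Suc k) (\<lambda>(p, q). \<Sum>i<3 ^ Suc k. \<Sum>j<3 ^ Suc k. X $$ (i, j) * power_kernel l (Suc k) p q i j) $$ (p, q)"
      using pq by (simp add: mult.commute del: power_kernel.simps)
  qed (simp_all add: tensor_map_def mult.commute)
qed

lemma bij_div_mod: "0 < b \<Longrightarrow> bij_betw (\<lambda>n. (n div b, n mod b)) {..<a * b} ({..<a} \<times> {..<b::nat})"
proof (rule bij_betw_byWitness[where f' = "\<lambda>(i, k). i * b + k"])
  show "(\<lambda>(i, k). i * b + k) ` ({..<a} \<times> {..<b}) \<subseteq> {..<a * b}" if "0 < b"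
  proof clarsimp
    fix i k assume "i < a" "k < b"
    then show "i * b + k < a * b"
      using mult_le_mono1[of "Suc i" a b] by simp
  qed
qed (auto intro: less_mult_imp_div_less)

lemma div_div_3: "n div 3 div 3 = n div (9::nat)"
  using div_mult2_eq[of n 3 3] by simp

lemma mod_9_div_3: "n mod 9 div 3 = n div 3 mod (3::nat)"
  using mod_mult2_eq[of n 3 3] by simp

lemma power_kernel_2:
  "power_kernel l 2 p q i j = werner l (p div 3 mod 3) (q div 3 mod 3) (i div 3 mod 3) (j div 3 mod 3) *
     werner l (p mod 3) (q mod 3) (i mod 3) (j mod 3)"
  by (simp add: numeral_2_eq_2)

lemma power_kernel_add_2:
  "power_kernel l (Suc (Suc k)) p q i j = power_kernel l k (p div 9) (q div 9) (i div 9) (j div 9) *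
     power_kernel l 2 (p mod 9) (q mod 9) (i mod 9) (j mod 9)"
  by (simp add: power_kernel_2 div_div_3 mod_9_div_3 mod_mod_cancel)

lemma power_kernel_3:
  "power_kernel l 3 p q i j = werner l (p div 9 mod 3) (q div 9 mod 3) (i div 9 mod 3) (j div 9 mod 3) *
     (werner l (p div 3 mod 3) (q div 3 mod 3) (i div 3 mod 3) (j div 3 mod 3) *
      werner l (p mod 3) (q mod 3) (i mod 3) (j mod 3))"
proof -
  have "power_kernel l 3 = power_kernel l (Suc (Suc (Suc 0)))"
    by (simp only: numeral_3_eq_3)
  then show ?thesis
    unfolding power_kernel_add_2 by (simp add: power_kernel_2 mod_9_div_3 mod_mod_cancel)
qed

text \<open>\<open>mixed_werner\<close> covers a single factor only for 1/3 \<le> l, so the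
  induction starts from exponents 2 and 3 and splits off two factors, one base-9 digit, at a
  time.\<close>

lemma mixed_power_kernel:
  assumes l: "1/4 \<le> l" "l \<le> 1" and k: "2 \<le> k"
  shows "mixed {..<3 ^ k} 1 (power_kernel l k)"
proof -
  have two: "mixed {..<9} 1 (power_kernel l 2)"
  proof -
    have f: "bij_betw (\<lambda>n. (n div 3, n mod 3)) {..<9::nat} ({..<3} \<times> {..<3})"
      using bij_div_mod[of 3 3] by simp
    show ?thesis
      by (rule mixed.cong[OF mixed_reindex[OF mixed_werner_pair[OF l] f]])
        (simp add: power_kernel_2 less_mult_imp_div_less)
  qed
  have three: "mixed {..<27} 1 (power_kernel l 3)"
  proof -
    have f: "bij_betw (\<lambda>n. (n div 9, n mod 9 div 3, n mod 3)) {..<27::nat} ({..<3} \<times> {..<3} \<times> {..<3})"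
    proof (rule bij_betw_byWitness[where f' = "\<lambda>(x, y, z). 9 * x + 3 * y + z"])
      show "\<forall>n\<in>{..<27::nat}. (case (n div 9, n mod 9 div 3, n mod 3) of (x, y, z) \<Rightarrow> 9 * x + 3 * y + z) = n"
      proof
        fix n :: nat
        have "n mod 9 mod 3 = n mod 3"
          by (simp add: mod_mod_cancel)
        then show "(case (n div 9, n mod 9 div 3, n mod 3) of (x, y, z) \<Rightarrow> 9 * x + 3 * y + z) = n"
          using div_mult_mod_eq[of n 9] div_mult_mod_eq[of "n mod 9" 3] unfolding prod.case by linarith
      qed
      show "\<forall>x\<in>{..<3} \<times> {..<3} \<times> {..<3::nat}. (\<lambda>n. (n div 9, n mod 9 div 3, n mod 3))
          (case x of (x, y, z) \<Rightarrow> 9 * x + 3 * y + z) = x"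
        by (auto simp: lessThan_3)
      show "(\<lambda>n. (n div 9, n mod 9 div 3, n mod 3)) ` {..<27::nat} \<subseteq> {..<3} \<times> {..<3} \<times> {..<3}"
        unfolding mod_9_div_3 by (auto intro: less_mult_imp_div_less)
      show "(\<lambda>(x, y, z). 9 * x + 3 * y + z) ` ({..<3} \<times> {..<3} \<times> {..<3}) \<subseteq> {..<27::nat}"
        by auto
    qed
    show ?thesis
      by (rule mixed.cong[OF mixed_reindex[OF mixed_werner_triple[OF l] f]])
        (simp add: power_kernel_3 mod_9_div_3 less_mult_imp_div_less)
  qed
  have "mixed {..<3 ^ (n + 2)} 1 (power_kernel l (n + 2))" for n
  proof (induction n rule: nat_less_induct)
    case (1 n)
    consider "n = 0" | "n = 1" | m where "n = m + 2"
      by (metis add.commute le_Suc_ex less_2_cases linorder_not_less numeral_1_eq_Suc_0 numerals(1))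
    then show ?case
    proof cases
      case 1
      then have "n + 2 = 2" by simp
      with two show ?thesis by (simp only:) simp
    next
      case 2
      then have "n + 2 = 3" by simp
      with three show ?thesis by (simp only:) simp
    next
      case (3 m)
      then have "m < n" by simp
      with 1 have "mixed {..<3 ^ (m + 2)} 1 (power_kernel l (m + 2))" by blast
      from mixed_reindex[OF mixed_tensor[OF this two] bij_div_mod]
      have "mixed {..<3 ^ (m + 2) * 9} 1 (power_kernel l (Suc (Suc (m + 2))))"
        unfolding power_kernel_add_2 by simp
      moreover have "3 ^ (n + 2) = 3 ^ (m + 2) * (9::nat)" "n + 2 = Suc (Suc (m + 2))"
        using 3 by simp_all
      ultimately show ?thesis by metis
    qed
  qed
  from this[of "k - 2"] show ?thesis
    unfolding le_add_diff_inverse2[OF k] .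
qed

theorem theorem6p1:
  fixes l :: real and k :: nat
  assumes "1/4 \<le> l" and "l \<le> 1" and "2 \<le> k"
  shows "in_conv_Aut (3 ^ k) (tensor_pow 3 (T_lam l) k)"
  by (rule in_conv_AutI[OF mixed_power_kernel[OF assms] tensor_pow_T_lam])

end
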